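(* Let $T$ be a Borel automorphism of $\mathbb{R}^n$ and let $\{\theta_j : 0 \le j \le n\} \subset \mathbb{R}^n$ be a set of $n+1$ points such that $\theta_j - \theta_0$, $j = 1,2,\ldots,n$, is a basis for $\mathbb{R}^n$. Suppose that there are $\varphi_j \in \mathbb{R}^n$ and $\Psi_j \in \mathcal{S}_+(n)$ such that $$N(\theta_j, I)\,T^{-1} = N(\varphi_j, \Psi_j), \qquad 0 \le j \le n,$$ where $I$ is the $n\times n$ identity matrix. Then $T$ is an affine automorphism, i.e. there exist a real nonsingular $n \times n$ matrix $A$ and $a \in \mathbb{R}^n$ such that $T(x) = Ax + a$ for Lebesgue-almost every $x \in \mathbb{R}^n$.
   Context: A Borel automorphism of $\mathbb{R}^n$ is a bijection $T:\mathbb{R}^n \to \mathbb{R}^n$ such that both $T$ and $T^{-1}$ are Borel measurable. $\mathcal{S}_+(n)$ is the set of real symmetric positive definite $n \times n$ matrices. For $\theta \in \mathbb{R}^n$ and $\Sigma \in \mathcal{S}_+(n)$, $N(\theta,\Sigma)$ is the Gaussian probability measure on $\mathbb{R}^n$ with mean $\theta$ and covariance matrix $\Sigma$, i.e. with density $(2\pi)^{-n/2}|\Sigma|^{-1/2}\exp\left(-\tfrac12 (x-\theta)'\Sigma^{-1}(x-\theta)\right)$. For a measure $\mu$, $\mu T^{-1}$ denotes the push-forward $E \mapsto \mu(T^{-1}(E))$. *)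

theory Defs
  imports "HOL-Analysis.Analysis"
begin

definition borel_automorphism :: "('a::topological_space \<Rightarrow> 'a) \<Rightarrow> bool" where
  "borel_automorphism T \<longleftrightarrow>
     bij T \<and> T \<in> borel_measurable borel \<and> inv T \<in> borel_measurable borel"

definition sym_pos_def :: "(real ^ 'n ^ 'n) set" where
  "sym_pos_def = {\<Sigma>. transpose \<Sigma> = \<Sigma> \<and> (\<forall>x. x \<noteq> 0 \<longrightarrow> x \<bullet> (\<Sigma> *v x) > 0)}"

(* Meaningful only for covariance matrices in sym_pos_def, the only ones it is used for. *)
definition gaussian_density :: "real ^ 'n \<Rightarrow> real ^ 'n ^ 'n \<Rightarrow> real ^ 'n \<Rightarrow> real" where
  "gaussian_density \<theta> \<Sigma> x =
     (2 * pi) powr (- real CARD('n) / 2) * det \<Sigma> powr (- 1 / 2) *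
     exp (- (1 / 2) * ((x - \<theta>) \<bullet> (matrix_inv \<Sigma> *v (x - \<theta>))))"

definition gaussian :: "real ^ 'n \<Rightarrow> real ^ 'n ^ 'n \<Rightarrow> (real ^ 'n) measure" where
  "gaussian \<theta> \<Sigma> = density lborel (\<lambda>x. ennreal (gaussian_density \<theta> \<Sigma> x))"

end

theory Submission
  imports Defs "HOL-Probability.Distributions"
begin

text \<open>
  Write \<open>p j\<close> for the density of \<open>N(\<theta> j, I)\<close> and \<open>q j\<close> for that of \<open>N(\<phi> j, \<Psi> j)\<close>. Since \<open>T\<close> is
  injective with a measurable inverse, it carries likelihood ratios to likelihood ratios:
  \<open>q j (T x) / q 0 (T x) = p j x / p 0 x\<close> almost everywhere (\<open>likelihood_ratio_transport\<close>). The
  logarithm of the right-hand side is the affine function \<open>(\<theta> j - \<theta> 0) \<bullet> x + const\<close>, because the two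
  covariances agree; the logarithm of the left-hand side is a quadratic polynomial in \<open>T x\<close>.

  The quadratic part of that polynomial vanishes. For every real \<open>t\<close> the integrals of
  \<open>p 0 * (p j / p 0) powr t\<close> and of \<open>q 0 * (q j / q 0) powr t\<close> coincide, and the first one is finite,
  being the integral of the exponential of a linear function minus \<open>x \<bullet> x / 2\<close>. If the inverse
  matrices of \<open>\<Psi> j\<close> and \<open>\<Psi> 0\<close> had different quadratic forms, then for a suitable \<open>t\<close> the exponent in
  the second integral would be strictly convex along some direction, and translation invariance of
  Lebesgue measure would make the integral infinite (\<open>quadratic_form_eq_if_ratio_powr_finite\<close>).

  So for each \<open>j\<close> there are \<open>m j\<close> and \<open>\<gamma> j\<close> with \<open>(\<theta> j - \<theta> 0) \<bullet> x = m j \<bullet> T x + \<gamma> j\<close> almost everywhere.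
  As the vectors \<open>\<theta> j - \<theta> 0\<close> form a basis, this says \<open>x = G (T x) + c\<close> with \<open>G\<close> linear. The closed
  set \<open>c + range G\<close> then has full measure, hence is the whole space; so \<open>G\<close> is invertible, and solving
  for \<open>T x\<close> gives the claim.
\<close>

section \<open>Exponential integrals\<close>

lemma lborel_not_AE_False: "\<not> (AE x in (lborel :: 'a::euclidean_space measure). False)"
  by (simp add: ae_filter_eq_bot_iff flip: trivial_limit_def)

lemma nn_integral_lborel_shift:
  fixes v :: "'a::euclidean_space"
  assumes [measurable]: "g \<in> borel_measurable borel"
  shows "(\<integral>\<^sup>+y. g (v + y) \<partial>lborel) = (\<integral>\<^sup>+y. g y \<partial>lborel)"
proof -
  have "(\<integral>\<^sup>+y. g y \<partial>lborel) = (\<integral>\<^sup>+y. g y \<partial>distr lborel borel ((+) v))"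
    by (simp add: lborel_distr_plus)
  also have "\<dots> = (\<integral>\<^sup>+y. g (v + y) \<partial>lborel)"
    by (subst nn_integral_distr) auto
  finally show ?thesis by simp
qed

text \<open>
  Replacing \<open>y\<close> by \<open>v + y\<close> or \<open>- v + y\<close> leaves the integral \<open>I\<close> unchanged, while the arithmetic mean of
  the two shifted integrands dominates their geometric mean, which is at least \<open>exp d\<close> times the
  original integrand. Hence \<open>exp d * I \<le> I\<close>, and \<open>I\<close>, which is not zero, must be infinite. This
  shows divergence in any dimension without diagonalising a quadratic form.
\<close>

lemma nn_integral_exp_eq_top_if_convex_along:
  fixes f :: "'a::euclidean_space \<Rightarrow> real"
  assumes [measurable]: "f \<in> borel_measurable borel"
    and "d > 0"
    and gap: "\<And>y. f (v + y) + f (- v + y) \<ge> 2 * f y + 2 * d"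
  shows "(\<integral>\<^sup>+y. ennreal (exp (f y)) \<partial>lborel) = \<infinity>"
proof (rule ccontr)
  let ?I = "\<integral>\<^sup>+y. ennreal (exp (f y)) \<partial>lborel"
  assume "?I \<noteq> \<infinity>"
  then obtain i where i: "?I = ennreal i" "i \<ge> 0"
    by (cases ?I) auto
  have le: "2 * exp d * exp (f y) \<le> exp (f (v + y)) + exp (f (- v + y))" for y
  proof -
    let ?a = "f (v + y)" and ?b = "f (- v + y)"
    have "exp d * exp (f y) \<le> exp (?a / 2 + ?b / 2)"
      using gap[of y] by (simp flip: exp_add)
    \<comment> \<open>arithmetic-geometric mean inequality, from the square of a difference of half exponentials\<close>
    also have "2 * \<dots> \<le> exp ?a + exp ?b"
      using zero_le_power2[of "exp (?a / 2) - exp (?b / 2)"]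
      by (simp add: power2_diff exp_add flip: exp_double)
    finally show ?thesis by simp
  qed
  have "ennreal (2 * exp d) * ?I = (\<integral>\<^sup>+y. ennreal (2 * exp d * exp (f y)) \<partial>lborel)"
    by (simp add: ennreal_mult nn_integral_cmult)
  also have "\<dots> \<le> (\<integral>\<^sup>+y. ennreal (exp (f (v + y))) + ennreal (exp (f (- v + y))) \<partial>lborel)"
    using le by (intro nn_integral_mono) (simp flip: ennreal_plus)
  also have "\<dots> = (\<integral>\<^sup>+y. ennreal (exp (f (v + y))) \<partial>lborel) + (\<integral>\<^sup>+y. ennreal (exp (f (- v + y))) \<partial>lborel)"
    by (intro nn_integral_add) auto
  also have "\<dots> = ?I + ?I"
    using nn_integral_lborel_shift[of "\<lambda>y. ennreal (exp (f y))" v]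
      nn_integral_lborel_shift[of "\<lambda>y. ennreal (exp (f y))" "- v"] by simp
  finally have "2 * exp d * i \<le> 2 * i"
    using i by (simp flip: ennreal_mult ennreal_plus)
  moreover have "exp d > 1" using \<open>d > 0\<close> by simp
  ultimately have "i = 0"
    using i(2) mult_strict_right_mono[of 1 "exp d" i] by fastforce
  then have "AE y in (lborel :: 'a measure). ennreal (exp (f y)) = 0"
    using i(1) by (subst nn_integral_0_iff_AE[symmetric]) auto
  then show False
    using lborel_not_AE_False[where 'a = 'a] by simp
qed

lemma nn_integral_exp_linear_minus_square:
  fixes b :: "'a::euclidean_space"
  shows "(\<integral>\<^sup>+x. ennreal (exp (b \<bullet> x - (x \<bullet> x) / 2)) \<partial>lborel) < \<infinity>"
proof -
  have one: "(\<integral>\<^sup>+x. ennreal (exp (m * x - x\<^sup>2 / 2)) \<partial>lborel) < \<infinity>" for m :: real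
  proof -
    \<comment> \<open>completing the square turns the integrand into a multiple of a normal density\<close>
    have "exp (m * x - x\<^sup>2 / 2) = sqrt (2 * pi) * exp (m\<^sup>2 / 2) * normal_density m 1 x" for x
      by (simp add: normal_density_def field_simps power2_diff flip: exp_add)
    then have "integrable lborel (\<lambda>x. exp (m * x - x\<^sup>2 / 2))"
      by simp
    then show ?thesis
      by (subst nn_integral_eq_integral) (auto simp: less_top)
  qed
  have "b \<bullet> x - (x \<bullet> x) / 2 = (\<Sum>i\<in>Basis. (b \<bullet> i) * (x \<bullet> i) - (x \<bullet> i)\<^sup>2 / 2)" for x
    by (simp add: euclidean_inner[of b x] euclidean_inner[of x x] sum_subtractf
        sum_divide_distrib power2_eq_square)
  then have "(\<integral>\<^sup>+x. ennreal (exp (b \<bullet> x - (x \<bullet> x) / 2)) \<partial>lborel)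
      = (\<integral>\<^sup>+x. (\<Prod>i\<in>Basis. ennreal (exp ((b \<bullet> i) * (x \<bullet> i) - (x \<bullet> i)\<^sup>2 / 2))) \<partial>lborel)"
    by (simp add: exp_sum prod_ennreal)
  also have "\<dots> = (\<Prod>i\<in>(Basis::'a set). \<integral>\<^sup>+x. ennreal (exp ((b \<bullet> i) * x - x\<^sup>2 / 2)) \<partial>lborel)"
    by (rule nn_integral_lborel_prod) auto
  also have "\<dots> < \<infinity>"
    using one by (simp add: ennreal_prod_eq_top flip: less_top)
  finally show ?thesis .
qed


section \<open>Likelihood ratios under a change of variables\<close>

text \<open>
  The function \<open>p1 / p0\<close> is the density of the second source measure relative to the first. Written
  as a function of \<open>T x\<close> through the left inverse \<open>S\<close>, it passes through the push-forward, so
  \<open>(p1 / p0) \<circ> S\<close> is a density of the second image measure relative to the first; by uniqueness of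
  densities it agrees almost everywhere with \<open>q1 / q0\<close>.
\<close>

lemma likelihood_ratio_transport:
  fixes p0 p1 :: "'a \<Rightarrow> real" and q0 q1 :: "'b \<Rightarrow> real"
  assumes "sigma_finite_measure N"
    and [measurable]: "T \<in> measurable M N" "S \<in> measurable N M"
    and inv: "\<And>x. x \<in> space M \<Longrightarrow> S (T x) = x"
    and [measurable]: "p0 \<in> borel_measurable M" "p1 \<in> borel_measurable M"
      "q0 \<in> borel_measurable N" "q1 \<in> borel_measurable N"
    and pos: "\<And>x. p0 x > 0" "\<And>x. p1 x > 0" "\<And>y. q0 y > 0" "\<And>y. q1 y > 0"
    and push0: "distr (density M p0) N T = density N q0"
    and push1: "distr (density M p1) N T = density N q1"
  shows "AE x in M. q1 (T x) / q0 (T x) = p1 x / p0 x"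
proof -
  let ?r = "\<lambda>x. ennreal (p1 x / p0 x)"
  have nonneg: "0 \<le> p0 x" "0 \<le> p1 x" "0 \<le> q0 y" "0 \<le> q1 y" for x y
    using pos by (simp_all add: less_imp_le)
  have "density M p1 = density (density M p0) ?r"
    using pos(1)[THEN less_imp_neq] nonneg
    by (subst density_density_eq) (auto simp flip: ennreal_mult)
  also have "\<dots> = density (density M p0) (\<lambda>x. ?r (S (T x)))"
    using inv by (intro density_cong) (auto intro!: AE_I2)
  finally have "density N q1 = density (distr (density M p0) N T) (\<lambda>y. ?r (S y))"
    using push1 by (subst density_distr) auto
  also have "\<dots> = density N (\<lambda>y. ennreal (q0 y) * ?r (S y))"
    unfolding push0 by (subst density_density_eq) auto
  finally have "AE y in N. ennreal (q1 y) = ennreal (q0 y) * ?r (S y)"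
    by (subst (asm) sigma_finite_measure.density_unique_iff[OF assms(1)]) auto
  then have "AE y in N. q1 y / q0 y = p1 (S y) / p0 (S y)"
  proof (rule AE_mp, intro AE_I2 impI)
    fix y assume "ennreal (q1 y) = ennreal (q0 y) * ?r (S y)"
    then have "q1 y = q0 y * (p1 (S y) / p0 (S y))"
      using nonneg by (simp flip: ennreal_mult)
    then show "q1 y / q0 y = p1 (S y) / p0 (S y)"
      using pos(3)[of y] by simp
  qed
  \<comment> \<open>null sets are pulled back along \<open>T\<close> through the push-forward identity for \<open>p0\<close> and \<open>q0\<close>\<close>
  then have "AE y in distr (density M p0) N T. q1 y / q0 y = p1 (S y) / p0 (S y)"
    unfolding push0 by (subst AE_density) auto
  then have "AE x in density M p0. q1 (T x) / q0 (T x) = p1 (S (T x)) / p0 (S (T x))"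
    by (rule AE_distrD[rotated]) auto
  then have "AE x in M. q1 (T x) / q0 (T x) = p1 (S (T x)) / p0 (S (T x))"
    using pos(1) by (subst (asm) AE_density) auto
  then show ?thesis
    using AE_space by eventually_elim (simp add: inv)
qed

text \<open>
  Moments of the likelihood ratio (Renyi or Hellinger integrals) depend only on its distribution under
  the first measure, and are therefore invariants of the change of variables. They are the tool by
  which integrability is transferred from the source to the image.
\<close>

lemma nn_integral_likelihood_ratio_powr:
  fixes p0 p1 :: "'a \<Rightarrow> real" and q0 q1 :: "'b \<Rightarrow> real"
  assumes [measurable]: "T \<in> measurable M N"
    "p0 \<in> borel_measurable M" "p1 \<in> borel_measurable M"
    "q0 \<in> borel_measurable N" "q1 \<in> borel_measurable N"
    and push0: "distr (density M p0) N T = density N q0"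
    and ratio: "AE x in M. q1 (T x) / q0 (T x) = p1 x / p0 x"
  shows "(\<integral>\<^sup>+y. ennreal (q0 y) * ennreal ((q1 y / q0 y) powr t) \<partial>N)
       = (\<integral>\<^sup>+x. ennreal (p0 x) * ennreal ((p1 x / p0 x) powr t) \<partial>M)"
proof -
  have "(\<integral>\<^sup>+y. ennreal (q0 y) * ennreal ((q1 y / q0 y) powr t) \<partial>N)
      = (\<integral>\<^sup>+y. ennreal ((q1 y / q0 y) powr t) \<partial>distr (density M p0) N T)"
    unfolding push0 by (subst nn_integral_density) auto
  also have "\<dots> = (\<integral>\<^sup>+x. ennreal (p0 x) * ennreal ((q1 (T x) / q0 (T x)) powr t) \<partial>M)"
    by (subst nn_integral_distr) (auto simp: nn_integral_density)
  also have "\<dots> = (\<integral>\<^sup>+x. ennreal (p0 x) * ennreal ((p1 x / p0 x) powr t) \<partial>M)"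
    using ratio by (intro nn_integral_cong_AE) auto
  finally show ?thesis .
qed


section \<open>Gaussian densities\<close>

text \<open>
  Absorbing the normalising constant into the exponent makes logarithms of densities quadratic
  polynomials. The constant is positive because a positive definite matrix has trivial kernel, hence nonzero determinant.
\<close>

lemma gaussian_density_eq_exp:
  fixes \<Sigma> :: "real ^ 'n ^ 'n"
  assumes "\<Sigma> \<in> sym_pos_def"
  obtains k where "\<And>\<theta> x. gaussian_density \<theta> \<Sigma> x
    = exp (k - (x - \<theta>) \<bullet> (matrix_inv \<Sigma> *v (x - \<theta>)) / 2)"
proof -
  have "\<forall>x. \<Sigma> *v x = 0 \<longrightarrow> x = 0"
    using assms unfolding sym_pos_def_def by force
  then have "invertible \<Sigma>"
    using matrix_left_invertible_ker invertible_left_inverse by blast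
  then have "det \<Sigma> \<noteq> 0"
    by (simp add: invertible_det_nz)
  define c where "c = (2 * pi) powr (- real CARD('n) / 2) * det \<Sigma> powr (- 1 / 2)"
  have "c > 0"
    using \<open>det \<Sigma> \<noteq> 0\<close> by (simp add: c_def)
  have "gaussian_density \<theta> \<Sigma> x = exp (ln c - (x - \<theta>) \<bullet> (matrix_inv \<Sigma> *v (x - \<theta>)) / 2)" for \<theta> x
  proof -
    have "gaussian_density \<theta> \<Sigma> x
      = exp (ln c) * exp (- (1 / 2) * ((x - \<theta>) \<bullet> (matrix_inv \<Sigma> *v (x - \<theta>))))"
      using \<open>c > 0\<close> by (simp only: gaussian_density_def c_def exp_ln)
    then show ?thesis
      by (simp only: flip: exp_add) simp
  qed
  then show ?thesis by (rule that)
qed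

lemma gaussian_density_pos: "\<Sigma> \<in> sym_pos_def \<Longrightarrow> gaussian_density \<theta> \<Sigma> x > 0"
  by (metis gaussian_density_eq_exp exp_gt_zero)

lemma borel_measurable_gaussian_density [measurable]:
  "gaussian_density \<theta> \<Sigma> \<in> borel_measurable borel"
proof -
  have "continuous_on UNIV (gaussian_density \<theta> \<Sigma>)"
    unfolding gaussian_density_def
    by (intro continuous_intros matrix_vector_mult_linear_continuous_on
        continuous_on_compose2[OF matrix_vector_mult_linear_continuous_on]) auto
  then show ?thesis
    by (rule borel_measurable_continuous_onI)
qed

lemma mat_1_in_sym_pos_def: "(mat 1 :: real ^ 'n ^ 'n) \<in> sym_pos_def"
  by (simp add: sym_pos_def_def transpose_mat)

lemma gaussian_density_mat_1_eq_exp: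
  obtains k where "\<And>(\<theta> :: real ^ 'n) x. gaussian_density \<theta> (mat 1) x
    = exp (k - (x - \<theta>) \<bullet> (x - \<theta>) / 2)"
proof -
  have "matrix_inv (mat 1) = (mat 1 :: real ^ 'n ^ 'n)"
    using someI[of "\<lambda>A'. mat 1 ** A' = (mat 1 :: real ^ 'n ^ 'n) \<and> A' ** mat 1 = mat 1" "mat 1"]
    by (simp add: matrix_inv_def)
  then show ?thesis
    using gaussian_density_eq_exp[OF mat_1_in_sym_pos_def[where 'n='n]] that by auto
qed

text \<open>
  With a common covariance the terms \<open>x \<bullet> x / 2\<close> of the two exponents cancel.
\<close>

lemma ln_gaussian_density_mat_1_ratio:
  fixes \<theta>0 \<theta>1 :: "real ^ 'n"
  obtains \<alpha> where "\<And>x. ln (gaussian_density \<theta>1 (mat 1) x / gaussian_density \<theta>0 (mat 1) x)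
    = (\<theta>1 - \<theta>0) \<bullet> x + \<alpha>"
proof -
  obtain k where k: "\<And>(\<theta> :: real ^ 'n) x. gaussian_density \<theta> (mat 1) x
    = exp (k - (x - \<theta>) \<bullet> (x - \<theta>) / 2)"
    using gaussian_density_mat_1_eq_exp by blast
  show ?thesis
    by (rule that[of "\<theta>0 \<bullet> \<theta>0 / 2 - \<theta>1 \<bullet> \<theta>1 / 2"])
       (simp add: k inner_diff inner_commute field_simps flip: exp_diff)
qed

text \<open>
  Multiplying a Gaussian density by the exponential of a linear function only shifts its mean and
  rescales it, so these moments are finite for every \<open>t\<close>, negative ones and those beyond \<open>1\<close> included.
\<close>

lemma nn_integral_gaussian_ratio_powr_finite:
  fixes \<theta>0 \<theta>1 :: "real ^ 'n"
  shows "(\<integral>\<^sup>+x. ennreal (gaussian_density \<theta>0 (mat 1) x)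
      * ennreal ((gaussian_density \<theta>1 (mat 1) x / gaussian_density \<theta>0 (mat 1) x) powr t) \<partial>lborel) < \<infinity>"
    (is "?I < \<infinity>")
proof -
  obtain k where k: "\<And>(\<theta> :: real ^ 'n) x. gaussian_density \<theta> (mat 1) x
    = exp (k - (x - \<theta>) \<bullet> (x - \<theta>) / 2)"
    using gaussian_density_mat_1_eq_exp by blast
  obtain \<alpha> where \<alpha>: "\<And>x. ln (gaussian_density \<theta>1 (mat 1) x / gaussian_density \<theta>0 (mat 1) x)
    = (\<theta>1 - \<theta>0) \<bullet> x + \<alpha>"
    using ln_gaussian_density_mat_1_ratio by blast
  let ?b = "\<theta>0 + t *\<^sub>R (\<theta>1 - \<theta>0)" and ?c = "k - \<theta>0 \<bullet> \<theta>0 / 2 + t * \<alpha>"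
  have "ennreal (gaussian_density \<theta>0 (mat 1) x)
      * ennreal ((gaussian_density \<theta>1 (mat 1) x / gaussian_density \<theta>0 (mat 1) x) powr t)
      = ennreal (exp ?c) * ennreal (exp (?b \<bullet> x - x \<bullet> x / 2))" for x
  proof -
    have "(gaussian_density \<theta>1 (mat 1) x / gaussian_density \<theta>0 (mat 1) x) powr t
      = exp (t * ((\<theta>1 - \<theta>0) \<bullet> x + \<alpha>))"
      by (simp only: powr_def \<alpha>) (simp add: k)
    then show ?thesis
      by (simp add: k inner_diff inner_add inner_commute field_simps flip: exp_add ennreal_mult)
  qed
  then have "?I = ennreal (exp ?c) * (\<integral>\<^sup>+x. ennreal (exp (?b \<bullet> x - x \<bullet> x / 2)) \<partial>lborel)"
    by (simp add: nn_integral_cmult)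
  then show ?thesis
    using nn_integral_exp_linear_minus_square[of ?b] by (simp add: ennreal_mult_less_top)
qed

text \<open>
  The logarithm of the integrand has the quadratic part \<open>- (S0 + t (S1 - S0)) / 2\<close>, where \<open>S0\<close> and \<open>S1\<close>
  are the inverse covariances. If \<open>S0\<close> and \<open>S1\<close> differ on \<open>v\<close>, the quadratic form on \<open>v\<close> is a
  nonconstant affine function of \<open>t\<close>, so some \<open>t\<close> makes the exponent strictly convex along \<open>v\<close> and
  the integral diverges.
\<close>

lemma quadratic_form_eq_if_ratio_powr_finite:
  fixes \<phi>0 \<phi>1 :: "real ^ 'n"
  assumes "\<Psi>0 \<in> sym_pos_def" "\<Psi>1 \<in> sym_pos_def"
    and fin: "\<And>t. (\<integral>\<^sup>+y. ennreal (gaussian_density \<phi>0 \<Psi>0 y)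
      * ennreal ((gaussian_density \<phi>1 \<Psi>1 y / gaussian_density \<phi>0 \<Psi>0 y) powr t) \<partial>lborel) < \<infinity>"
  shows "v \<bullet> (matrix_inv \<Psi>1 *v v) = v \<bullet> (matrix_inv \<Psi>0 *v v)"
proof (rule ccontr)
  let ?S0 = "matrix_inv \<Psi>0" and ?S1 = "matrix_inv \<Psi>1"
  define \<delta> where "\<delta> = v \<bullet> (?S1 *v v) - v \<bullet> (?S0 *v v)"
  assume "v \<bullet> (?S1 *v v) \<noteq> v \<bullet> (?S0 *v v)"
  then have "\<delta> \<noteq> 0" by (simp add: \<delta>_def)
  \<comment> \<open>the value of \<open>t\<close> for which the form of \<open>S0 + t (S1 - S0)\<close> equals \<open>- 1\<close> on \<open>v\<close>\<close>
  define t where "t = - (v \<bullet> (?S0 *v v) + 1) / \<delta>"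
  have t: "v \<bullet> (?S0 *v v) + t * \<delta> = - 1"
    using \<open>\<delta> \<noteq> 0\<close> by (simp add: t_def)
  obtain k0 where k0: "\<And>\<theta> x. gaussian_density \<theta> \<Psi>0 x = exp (k0 - (x - \<theta>) \<bullet> (?S0 *v (x - \<theta>)) / 2)"
    using gaussian_density_eq_exp[OF assms(1)] by blast
  obtain k1 where k1: "\<And>\<theta> x. gaussian_density \<theta> \<Psi>1 x = exp (k1 - (x - \<theta>) \<bullet> (?S1 *v (x - \<theta>)) / 2)"
    using gaussian_density_eq_exp[OF assms(2)] by blast
  define h0 where "h0 y = ln (gaussian_density \<phi>0 \<Psi>0 y)" for y
  define h1 where "h1 y = ln (gaussian_density \<phi>1 \<Psi>1 y)" for y
  define f where "f y = h0 y + t * (h1 y - h0 y)" for y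
  have [measurable]: "h0 \<in> borel_measurable borel" "h1 \<in> borel_measurable borel"
    "f \<in> borel_measurable borel"
    unfolding h0_def[abs_def] h1_def[abs_def] f_def[abs_def] by measurable
  \<comment> \<open>second differences of a quadratic polynomial retain only its quadratic part\<close>
  have h0: "h0 (v + y) + h0 (- v + y) = 2 * h0 y - v \<bullet> (?S0 *v v)" for y
    by (simp add: h0_def k0 matrix_vector_mult_diff_distrib matrix_vector_right_distrib
        inner_diff inner_add field_simps)
  have h1: "h1 (v + y) + h1 (- v + y) = 2 * h1 y - v \<bullet> (?S1 *v v)" for y
    by (simp add: h1_def k1 matrix_vector_mult_diff_distrib matrix_vector_right_distrib
        inner_diff inner_add field_simps)
  have "f (v + y) + f (- v + y) = 2 * f y + 2 * (1 / 2)" for y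
  proof -
    have "f (v + y) + f (- v + y)
      = (h0 (v + y) + h0 (- v + y)) + t * ((h1 (v + y) + h1 (- v + y)) - (h0 (v + y) + h0 (- v + y)))"
      by (simp add: f_def algebra_simps)
    also have "\<dots> = 2 * f y - (v \<bullet> (?S0 *v v) + t * \<delta>)"
      by (simp only: h0 h1) (simp add: f_def \<delta>_def algebra_simps)
    finally show ?thesis by (simp add: t)
  qed
  then have "(\<integral>\<^sup>+y. ennreal (exp (f y)) \<partial>lborel) = \<infinity>"
    by (intro nn_integral_exp_eq_top_if_convex_along[where v = v and d = "1 / 2"]) auto
  moreover have "ennreal (exp (f y)) = ennreal (gaussian_density \<phi>0 \<Psi>0 y)
      * ennreal ((gaussian_density \<phi>1 \<Psi>1 y / gaussian_density \<phi>0 \<Psi>0 y) powr t)" for y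
    using gaussian_density_pos[OF assms(1), of \<phi>0 y] gaussian_density_pos[OF assms(2), of \<phi>1 y]
    by (simp add: f_def h0_def h1_def powr_def ln_div exp_add ennreal_mult)
  ultimately show False
    using fin[of t] by simp
qed

lemma ln_gaussian_density_ratio_affine:
  fixes \<phi>0 \<phi>1 :: "real ^ 'n"
  assumes "\<Psi>0 \<in> sym_pos_def" "\<Psi>1 \<in> sym_pos_def"
    and eq: "\<And>v. v \<bullet> (matrix_inv \<Psi>1 *v v) = v \<bullet> (matrix_inv \<Psi>0 *v v)"
  obtains m \<beta> where
    "\<And>y. ln (gaussian_density \<phi>1 \<Psi>1 y / gaussian_density \<phi>0 \<Psi>0 y) = m \<bullet> y + \<beta>"
proof -
  let ?S0 = "matrix_inv \<Psi>0" and ?S1 = "matrix_inv \<Psi>1"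
  obtain k0 where k0: "\<And>\<theta> x. gaussian_density \<theta> \<Psi>0 x = exp (k0 - (x - \<theta>) \<bullet> (?S0 *v (x - \<theta>)) / 2)"
    using gaussian_density_eq_exp[OF assms(1)] by blast
  obtain k1 where k1: "\<And>\<theta> x. gaussian_density \<theta> \<Psi>1 x = exp (k1 - (x - \<theta>) \<bullet> (?S1 *v (x - \<theta>)) / 2)"
    using gaussian_density_eq_exp[OF assms(2)] by blast
  \<comment> \<open>half the gradient of \<open>\<phi> \<bullet> (S *v y) + y \<bullet> (S *v \<phi>)\<close> in \<open>y\<close>; equal to \<open>S *v \<phi>\<close> for symmetric \<open>S\<close>\<close>
  define l where "l S \<phi> = (1 / 2) *\<^sub>R (S *v \<phi> + \<phi> v* S)" for S :: "real ^ 'n ^ 'n" and \<phi>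
  have expand: "(y - \<phi>) \<bullet> (S *v (y - \<phi>)) / 2 = y \<bullet> (S *v y) / 2 - l S \<phi> \<bullet> y + \<phi> \<bullet> (S *v \<phi>) / 2"
    for S :: "real ^ 'n ^ 'n" and \<phi> y
    by (simp add: l_def matrix_vector_mult_diff_distrib inner_diff inner_add dot_lmul_matrix
        inner_commute[of y "S *v \<phi>"] field_simps)
  show ?thesis
    by (rule that[of "l ?S1 \<phi>1 - l ?S0 \<phi>0"
          "k1 - k0 - \<phi>1 \<bullet> (?S1 *v \<phi>1) / 2 + \<phi>0 \<bullet> (?S0 *v \<phi>0) / 2"])
       (simp only: k0 k1 expand flip: exp_diff, simp add: eq inner_diff)
qed


section \<open>Affine relations\<close>

text \<open>
  Let \<open>g\<close> be the linear map with \<open>g (b j) = m j\<close> and \<open>G\<close> its adjoint. Then \<open>m j \<bullet> T x = b j \<bullet> G (T x)\<close>,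
  so \<open>x - G (T x)\<close> has almost everywhere the prescribed inner products \<open>\<gamma> j\<close> with a basis and is
  therefore constant.
\<close>

lemma AE_affine_if_linear_functionals:
  fixes T :: "'a::euclidean_space \<Rightarrow> 'a" and b m :: "'i \<Rightarrow> 'a"
  assumes "finite J" "inj_on b J" "independent (b ` J)" "span (b ` J) = UNIV"
    and ae: "\<And>j. j \<in> J \<Longrightarrow> AE x in lborel. b j \<bullet> x = m j \<bullet> T x + \<gamma> j"
  obtains G c where "linear G" "AE x in lborel. x = G (T x) + c"
proof -
  obtain g where "linear g" and g: "\<And>j. j \<in> J \<Longrightarrow> g (b j) = m j"
    using linear_independent_extend[OF assms(3), of "m \<circ> inv_into J b"] assms(2) by auto
  define G where "G = adjoint g"
  have "linear G"
    using \<open>linear g\<close> by (simp add: G_def adjoint_linear)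
  have G: "b j \<bullet> G y = m j \<bullet> y" if "j \<in> J" for j y
    using adjoint_works[OF \<open>linear g\<close>, of "b j" y] g[OF that] by (simp add: G_def)
  have all: "AE x in lborel. \<forall>j\<in>J. b j \<bullet> x = m j \<bullet> T x + \<gamma> j"
    using ae \<open>finite J\<close> by (simp add: AE_finite_all)
  \<comment> \<open>the constant is read off at any one point where all the relations hold\<close>
  have "\<exists>z. \<forall>j\<in>J. b j \<bullet> z = m j \<bullet> T z + \<gamma> j"
  proof (rule ccontr)
    assume "\<not> ?thesis"
    with all have "AE x in (lborel :: 'a measure). False"
      by (auto elim!: eventually_mono)
    then show False
      using lborel_not_AE_False[where 'a = 'a] by contradiction
  qed
  then obtain z where z: "\<forall>j\<in>J. b j \<bullet> z = m j \<bullet> T z + \<gamma> j"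
    by blast
  have "AE x in lborel. x = G (T x) + (z - G (T z))"
    using all
  proof eventually_elim
    case (elim x)
    let ?w = "x - (G (T x) + (z - G (T z)))"
    have "b j \<bullet> ?w = 0" if "j \<in> J" for j
      using elim z that by (simp add: inner_diff_right inner_add_right G)
    then have "orthogonal ?w u" if "u \<in> b ` J" for u
      using that by (auto simp: orthogonal_def inner_commute)
    then have "orthogonal ?w ?w"
      using orthogonal_to_span assms(4) by blast
    then show ?case by (simp add: orthogonal_def)
  qed
  with \<open>linear G\<close> show ?thesis by (rule that)
qed

text \<open>
  Almost every point lies in the affine subspace \<open>c + range G\<close>. A closed set of full Lebesgue measure
  is the whole space, so \<open>G\<close> is onto and hence invertible.
\<close>

lemma AE_affine_inverse:
  fixes T :: "real ^ 'n \<Rightarrow> real ^ 'n"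
  assumes "linear G" and ae: "AE x in lborel. x = G (T x) + c"
  obtains A a where "invertible A" "AE x in lborel. T x = A *v x + a"
proof -
  have "closed ((+) c ` range G)"
    using \<open>linear G\<close> by (intro closed_translation closed_subspace linear_subspace_image) auto
  moreover have "AE x in lebesgue. x \<in> (+) c ` range G"
    using AE_completion[OF ae] by eventually_elim (metis add.commute image_eqI rangeI)
  ultimately have "y \<in> (+) c ` range G" for y
    by (rule mem_closed_if_AE_lebesgue)
  then have "surj G"
  proof -
    have "\<exists>x. y = G x" for y
    proof -
      have "c + y \<in> (+) c ` range G" by fact
      then show ?thesis by auto
    qed
    then show ?thesis by (simp add: surj_def)
  qed
  then obtain F where F: "linear F" "\<And>y. F (G y) = y" "\<And>y. G (F y) = y"
    using linear_surjective_isomorphism[OF \<open>linear G\<close>] by auto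
  have "F \<circ> G = id" "G \<circ> F = id"
    using F by auto
  then have "matrix F ** matrix G = mat 1" "matrix G ** matrix F = mat 1"
    using F(1) \<open>linear G\<close> by (simp_all add: matrix_id_mat_1 flip: matrix_compose)
  then have "invertible (matrix F)"
    unfolding invertible_def by blast
  moreover have "AE x in lborel. T x = matrix F *v x + - F c"
    using ae
  proof eventually_elim
    case (elim x)
    have "F x = F (G (T x) + c)" using elim by simp
    then show ?case
      using F by (simp add: matrix_works linear_add)
  qed
  ultimately show ?thesis by (rule that)
qed


section \<open>Automorphisms carrying Gaussians to Gaussians\<close>

theorem theorem3p1:
  fixes T :: "real ^ 'n \<Rightarrow> real ^ 'n"
    and \<theta> \<phi> :: "nat \<Rightarrow> real ^ 'n"
    and \<Psi> :: "nat \<Rightarrow> real ^ 'n ^ 'n"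
  assumes "borel_automorphism T"
    and "inj_on (\<lambda>j. \<theta> j - \<theta> 0) {1..CARD('n)}"
    and "independent ((\<lambda>j. \<theta> j - \<theta> 0) ` {1..CARD('n)})"
    and "span ((\<lambda>j. \<theta> j - \<theta> 0) ` {1..CARD('n)}) = UNIV"
    and "\<And>j. j \<le> CARD('n) \<Longrightarrow> \<Psi> j \<in> sym_pos_def"
    and "\<And>j. j \<le> CARD('n) \<Longrightarrow> distr (gaussian (\<theta> j) (mat 1)) borel T = gaussian (\<phi> j) (\<Psi> j)"
  shows "\<exists>A :: real ^ 'n ^ 'n. \<exists>a :: real ^ 'n.
           invertible A \<and> (AE x in lebesgue. T x = A *v x + a)"
proof -
  have [measurable]: "T \<in> borel_measurable borel" "inv T \<in> borel_measurable borel" and "bij T"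
    using assms(1) by (auto simp: borel_automorphism_def)
  let ?p = "\<lambda>j. gaussian_density (\<theta> j) (mat 1)" and ?q = "\<lambda>j. gaussian_density (\<phi> j) (\<Psi> j)"
  have push: "distr (density lborel (?p j)) lborel T = density lborel (?q j)" if "j \<le> CARD('n)" for j
  proof -
    have "distr (density lborel (?p j)) lborel T = distr (density lborel (?p j)) borel T"
      by (rule distr_cong) auto
    then show ?thesis
      using assms(6)[OF that] by (simp add: gaussian_def)
  qed
  have "\<exists>m \<gamma>. AE x in lborel. (\<theta> j - \<theta> 0) \<bullet> x = m \<bullet> T x + \<gamma>" if "j \<in> {1..CARD('n)}" for j
  proof -
    have j: "j \<le> CARD('n)" using that by simp
    have ratio: "AE x in lborel. ?q j (T x) / ?q 0 (T x) = ?p j x / ?p 0 x"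
    proof (rule likelihood_ratio_transport[where S = "inv T"])
      show "inv T (T x) = x" for x
        using \<open>bij T\<close> by (simp add: bij_is_inj)
    qed (use push[of 0] push[OF j] assms(5)[of 0] assms(5)[OF j] in
        \<open>auto simp: gaussian_density_pos mat_1_in_sym_pos_def lborel.sigma_finite_measure_axioms\<close>)
    have "(\<integral>\<^sup>+y. ennreal (?q 0 y) * ennreal ((?q j y / ?q 0 y) powr t) \<partial>lborel) < \<infinity>" for t
      using nn_integral_likelihood_ratio_powr[OF _ _ _ _ _ push ratio, of t]
        nn_integral_gaussian_ratio_powr_finite[of "\<theta> 0" "\<theta> j" t] by simp
    then have "v \<bullet> (matrix_inv (\<Psi> j) *v v) = v \<bullet> (matrix_inv (\<Psi> 0) *v v)" for v
      using assms(5) j by (intro quadratic_form_eq_if_ratio_powr_finite) auto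
    then obtain m \<beta> where m: "\<And>y. ln (?q j y / ?q 0 y) = m \<bullet> y + \<beta>"
      using ln_gaussian_density_ratio_affine[OF assms(5)[of 0] assms(5)[OF j]] by blast
    obtain \<alpha> where \<alpha>: "\<And>x. ln (?p j x / ?p 0 x) = (\<theta> j - \<theta> 0) \<bullet> x + \<alpha>"
      using ln_gaussian_density_mat_1_ratio by blast
    have "AE x in lborel. (\<theta> j - \<theta> 0) \<bullet> x = m \<bullet> T x + (\<beta> - \<alpha>)"
      using ratio
    proof eventually_elim
      case (elim x)
      then have "ln (?q j (T x) / ?q 0 (T x)) = ln (?p j x / ?p 0 x)" by simp
      then show ?case unfolding m \<alpha> by simp
    qed
    then show ?thesis by blast
  qed
  then obtain m \<gamma> where
    "\<And>j. j \<in> {1..CARD('n)} \<Longrightarrow> AE x in lborel. (\<theta> j - \<theta> 0) \<bullet> x = m j \<bullet> T x + \<gamma> j"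
    by metis
  then obtain G c where "linear G" "AE x in lborel. x = G (T x) + c"
    using AE_affine_if_linear_functionals[of "{1..CARD('n)}" "\<lambda>j. \<theta> j - \<theta> 0" m T \<gamma>] assms(2-4)
    by blast
  then obtain A a where "invertible A" "AE x in lborel. T x = A *v x + a"
    using AE_affine_inverse by blast
  then show ?thesis
    using AE_completion by blast
qed

end
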